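(* Let $G$ be a semi-topological group. If $A$ is an open dense subset of $G$ then $G=AA^{-1}$. In particular, if $A=A^{-1}$ then $G=A^{2}$.
   Context: A semi-topological group is a group $G$ which is also a topological space such that, for every fixed $g\in G$, the left multiplication map $x\mapsto gx$ and the right multiplication map $x\mapsto xg$ are continuous. $A^{-1}=\{a^{-1}\mid a\in A\}$; products of subsets are setwise products and $A^2=AA$. *)

theory Defs
  imports "HOL-Algebra.Coset" "HOL-Analysis.Abstract_Topology"
begin

locale semitopological_group = group G for G :: "('a, 'b) monoid_scheme" (structure) +
  fixes T :: "'a topology"
  assumes topspace_eq_carrier: "topspace T = carrier G"
    and continuous_left_mult: "g \<in> carrier G \<Longrightarrow> continuous_map T T (\<lambda>x. g \<otimes> x)"
    and continuous_right_mult: "g \<in> carrier G \<Longrightarrow> continuous_map T T (\<lambda>x. x \<otimes> g)"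

end

theory Submission
  imports Defs
begin

(* For g in G the set {x. g x \<in> A} is open by continuity of the left translation, and it is
   nonempty, so it meets the dense set A in some x; then g = (g x) x^-1 lies in A A^-1. *)

theorem proposition1:
  fixes G (structure) and T :: "'a topology" and A :: "'a set"
  assumes "semitopological_group G T"
    and "openin T A"
    and "T closure_of A = topspace T"
  shows "carrier G = A <#> (set_inv A) \<and> (A = set_inv A \<longrightarrow> carrier G = A <#> A)"
proof -
  interpret semitopological_group G T by fact
  have A_sub: "A \<subseteq> carrier G"
    using openin_subset[OF assms(2)] topspace_eq_carrier by simp
  \<comment> \<open>The empty set has empty closure, whereas the closure of \<open>A\<close> is the
    whole group and so contains \<open>\<one>\<close>.\<close>
  have "A \<noteq> {}"
    using assms(3) topspace_eq_carrier one_closed by force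
  then obtain a where a: "a \<in> A" "a \<in> carrier G"
    using A_sub by blast
  have "g \<in> A <#> set_inv A" if g: "g \<in> carrier G" for g
  proof -
    let ?U = "{x \<in> topspace T. g \<otimes> x \<in> A}"
    have "openin T ?U"
      using continuous_left_mult[OF g] assms(2) by (rule openin_continuous_map_preimage)
    \<comment> \<open>\<open>?U\<close> is the translate of \<open>A\<close> by
      \<open>inv g\<close>, so any point \<open>a\<close> of \<open>A\<close> supplies a point of
      it: \<open>inv g \<otimes> a\<close> solves g x = a.\<close>
    moreover have "inv g \<otimes> a \<in> ?U"
      using g a by (simp add: topspace_eq_carrier m_assoc[symmetric])
    ultimately have "A \<inter> ?U \<noteq> {}"
      using assms(3) dense_intersects_open by blast
    then obtain x where x: "x \<in> A" "x \<in> carrier G" "g \<otimes> x \<in> A"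
      using topspace_eq_carrier by auto
    have "g = (g \<otimes> x) \<otimes> inv x"
      using g x(2) by (simp add: m_assoc)
    then show ?thesis
      using x by (auto simp: set_mult_def SET_INV_def)
  qed
  moreover have "A <#> set_inv A \<subseteq> carrier G"
    using A_sub by (auto simp: set_mult_def SET_INV_def)
  ultimately have "carrier G = A <#> set_inv A"
    by blast
  \<comment> \<open>For symmetric \<open>A\<close>, replacing the factor \<open>set_inv A\<close> by
    \<open>A\<close> gives the second equation.\<close>
  then show ?thesis
    by metis
qed

end
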